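(* (Performance Difference Lemma) Let $\pi$ and $\pi'$ be any two ergodic policies. Then $$\rho(\pi')-\rho(\pi)=\mathbb{E}_{s\sim\lambda_{\pi'},\,a\sim\pi'}\big[\mathcal{A}_\pi(s,a)\big]=\sum_{s\in S}\sum_{a\in A}\lambda_{\pi'}(s)\,\pi'(s,a)\,\mathcal{A}_\pi(s,a).$$
   Context: Average reward dynamic programming. $S$ is a finite state space, $A$ a finite action set, $p(s,a,s')$ transition probabilities and $R:S\times A\times S\to\mathbb{R}$ a payoff function. A policy $\pi$ assigns to each $s\in S$ a probability measure $\pi(s,\cdot)$ on $A$; it generates the Markov chain on $S$ with kernel $K_\pi(s,s')=\sum_{a\in A}\pi(s,a)p(s,a,s')$. A policy is ergodic if this chain is irreducible and aperiodic; $\lambda_\pi$ denotes its unique stationary distribution. The average reward is $$\rho(\pi)=\lim_{T\to\infty}\frac1T\,\mathbb{E}_\pi\Big[\sum_{t=1}^TR(s(t),a(t),s(t+1))\Big]=\sum_{s,a,s'}\lambda_\pi(s)\pi(s,a)p(s,a,s')R(s,a,s').$$ The differential value function $h_\pi:S\to\mathbb{R}$ and the function $Q_\pi:S\times A\to\mathbb{R}$ satisfy $$h_\pi(s)=\sum_{a\in A}\pi(s,a)Q_\pi(s,a),\qquad Q_\pi(s,a)=\sum_{s'\in S}p(s,a,s')\big(R(s,a,s')-\rho(\pi)+h_\pi(s')\big)$$ ($h_\pi$ is determined up to an additive constant; any choice is allowed). The advantage function is $\mathcal{A}_\pi(s,a)=Q_\pi(s,a)-h_\pi(s)$. *)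

theory Defs
  imports "HOL-Probability.Probability"
begin

text \<open>The finite state space and the finite action set are types of class \<open>finite\<close>. Probability
  measures on them are \<open>pmf\<close>s: \<open>pmf (\<pi> s) a\<close> is $\pi(s,a)$ and \<open>pmf (p s a) s'\<close> is $p(s,a,s')$.\<close>

type_synonym ('s, 'a) transition = "'s \<Rightarrow> 'a \<Rightarrow> 's pmf"
type_synonym ('s, 'a) payoff = "'s \<Rightarrow> 'a \<Rightarrow> 's \<Rightarrow> real"
type_synonym ('s, 'a) policy = "'s \<Rightarrow> 'a pmf"

definition kernel ::
  "('s::finite, 'a::finite) transition \<Rightarrow> ('s, 'a) policy \<Rightarrow> 's \<Rightarrow> 's \<Rightarrow> real" where
  "kernel p \<pi> s s' = (\<Sum>a\<in>UNIV. pmf (\<pi> s) a * pmf (p s a) s')"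

primrec kernel_power :: "('s::finite \<Rightarrow> 's \<Rightarrow> real) \<Rightarrow> nat \<Rightarrow> 's \<Rightarrow> 's \<Rightarrow> real" where
  "kernel_power K 0 s s' = (if s = s' then 1 else 0)"
| "kernel_power K (Suc n) s s' = (\<Sum>u\<in>UNIV. K s u * kernel_power K n u s')"

definition irreducible_kernel :: "('s::finite \<Rightarrow> 's \<Rightarrow> real) \<Rightarrow> bool" where
  "irreducible_kernel K \<longleftrightarrow> (\<forall>s s'. \<exists>n. kernel_power K n s s' > 0)"

definition aperiodic_kernel :: "('s::finite \<Rightarrow> 's \<Rightarrow> real) \<Rightarrow> bool" where
  "aperiodic_kernel K \<longleftrightarrow> (\<forall>s. Gcd {n. n > 0 \<and> kernel_power K n s s > 0} = 1)"

definition ergodic_policy ::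
  "('s::finite, 'a::finite) transition \<Rightarrow> ('s, 'a) policy \<Rightarrow> bool" where
  "ergodic_policy p \<pi> \<longleftrightarrow> irreducible_kernel (kernel p \<pi>) \<and> aperiodic_kernel (kernel p \<pi>)"

definition stationary :: "('s::finite \<Rightarrow> 's \<Rightarrow> real) \<Rightarrow> 's pmf \<Rightarrow> bool" where
  "stationary K \<nu> \<longleftrightarrow> (\<forall>s'. (\<Sum>s\<in>UNIV. pmf \<nu> s * K s s') = pmf \<nu> s')"

definition stationary_distribution ::
  "('s::finite, 'a::finite) transition \<Rightarrow> ('s, 'a) policy \<Rightarrow> 's pmf" where
  "stationary_distribution p \<pi> = (THE \<nu>. stationary (kernel p \<pi>) \<nu>)"

text \<open>The joint law of the first \<open>T\<close> transitions $(s(t), a(t), s(t+1))$, $t = 1, \dots, T$, of the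
  controlled process started in \<open>s\<close>.\<close>

primrec trajectory ::
  "('s, 'a) transition \<Rightarrow> ('s, 'a) policy \<Rightarrow> nat \<Rightarrow> 's \<Rightarrow> ('s \<times> 'a \<times> 's) list pmf" where
  "trajectory p \<pi> 0 s = return_pmf []"
| "trajectory p \<pi> (Suc T) s =
     bind_pmf (\<pi> s) (\<lambda>a. bind_pmf (p s a) (\<lambda>s'.
       map_pmf (\<lambda>xs. (s, a, s') # xs) (trajectory p \<pi> T s')))"

definition expected_total_reward ::
  "('s, 'a) transition \<Rightarrow> ('s, 'a) payoff \<Rightarrow> 's pmf \<Rightarrow> ('s, 'a) policy \<Rightarrow> nat \<Rightarrow> real" where
  "expected_total_reward p R \<mu> \<pi> T =
     measure_pmf.expectation (bind_pmf \<mu> (trajectory p \<pi> T)) (\<lambda>xs. \<Sum>(s, a, s')\<leftarrow>xs. R s a s')"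

text \<open>The law \<open>\<mu>\<close> of the initial state $s(1)$ is kept as an explicit parameter; for an ergodic policy
  the limit exists and does not depend on it.\<close>

definition average_reward ::
  "('s, 'a) transition \<Rightarrow> ('s, 'a) payoff \<Rightarrow> 's pmf \<Rightarrow> ('s, 'a) policy \<Rightarrow> real" where
  "average_reward p R \<mu> \<pi> = lim (\<lambda>T. 1 / real T * expected_total_reward p R \<mu> \<pi> T)"

text \<open>A predicate rather than a function, because \<open>h\<close> is only determined up to an additive constant.\<close>

definition differential_values ::
  "('s::finite, 'a::finite) transition \<Rightarrow> ('s, 'a) payoff \<Rightarrow> 's pmf \<Rightarrow> ('s, 'a) policy \<Rightarrow>
   ('s \<Rightarrow> real) \<Rightarrow> ('s \<Rightarrow> 'a \<Rightarrow> real) \<Rightarrow> bool" where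
  "differential_values p R \<mu> \<pi> h Q \<longleftrightarrow>
     (\<forall>s. h s = (\<Sum>a\<in>UNIV. pmf (\<pi> s) a * Q s a)) \<and>
     (\<forall>s a. Q s a = (\<Sum>s'\<in>UNIV. pmf (p s a) s' * (R s a s' - average_reward p R \<mu> \<pi> + h s')))"

definition advantage :: "('s \<Rightarrow> real) \<Rightarrow> ('s \<Rightarrow> 'a \<Rightarrow> real) \<Rightarrow> 's \<Rightarrow> 'a \<Rightarrow> real" where
  "advantage h Q s a = Q s a - h s"

definition state_action_law :: "'s pmf \<Rightarrow> ('s, 'a) policy \<Rightarrow> ('s \<times> 'a) pmf" where
  "state_action_law \<nu> \<pi> = bind_pmf \<nu> (\<lambda>s. map_pmf (Pair s) (\<pi> s))"

end

theory Submission
  imports Defs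
begin

text \<open>Averaging the Bellman equation for \<open>Q\<close> against a stationary law of \<open>\<pi>'\<close> cancels the values
  of \<open>h\<close> and leaves the mean one-step payoff of \<open>\<pi>'\<close> minus \<open>\<rho>(\<pi>)\<close>. It remains to identify that mean
  with the limit defining \<open>\<rho>(\<pi>')\<close>. The expected total reward is the one-step payoff integrated against
  the occupation measures; the time-averaged occupation measures lie in a compact set, each of their
  limit points is stationary, and an irreducible kernel has only one stationary law, so they
  converge to it.\<close>

section \<open>Stochastic kernels and their powers\<close>

definition stochastic_kernel :: "('s::finite \<Rightarrow> 's \<Rightarrow> real) \<Rightarrow> bool" where
  "stochastic_kernel K \<longleftrightarrow> (\<forall>s s'. K s s' \<ge> 0) \<and> (\<forall>s. (\<Sum>s'\<in>UNIV. K s s') = 1)"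

lemma sum_pmf_UNIV [simp]: "(\<Sum>x\<in>UNIV. pmf M (x::'x::finite)) = 1"
  by (rule sum_pmf_eq_1) auto

lemma sum_pmf_times_const [simp]: "(\<Sum>x\<in>UNIV. pmf M (x::'x::finite) * c) = c"
  by (simp flip: sum_distrib_right)

lemma sum_kernel:
  "(\<Sum>s'\<in>UNIV. kernel p \<pi> s s' * f s') =
     (\<Sum>a\<in>UNIV. pmf (\<pi> s) a * (\<Sum>s'\<in>UNIV. pmf (p s a) s' * f s'))"
proof -
  have "(\<Sum>s'\<in>UNIV. kernel p \<pi> s s' * f s') =
      (\<Sum>s'\<in>UNIV. \<Sum>a\<in>UNIV. pmf (\<pi> s) a * (pmf (p s a) s' * f s'))"
    by (simp add: kernel_def sum_distrib_right mult.assoc)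
  also have "\<dots> = (\<Sum>a\<in>UNIV. \<Sum>s'\<in>UNIV. pmf (\<pi> s) a * (pmf (p s a) s' * f s'))"
    by (rule sum.swap)
  finally show ?thesis by (simp add: sum_distrib_left)
qed

text \<open>Testing \<open>sum_kernel\<close> against the constant 1 reduces the row sums to the
  total masses of the \<open>pmf\<close>s.\<close>

lemma stochastic_kernel_kernel: "stochastic_kernel (kernel p \<pi>)"
  using sum_kernel[of p \<pi> _ "\<lambda>_. 1"]
  by (simp add: stochastic_kernel_def kernel_def sum_nonneg)

lemma kernel_power_nonneg:
  assumes "stochastic_kernel K"
  shows "kernel_power K n s s' \<ge> 0"
  using assms by (induction n arbitrary: s) (auto simp: stochastic_kernel_def intro!: sum_nonneg)

text \<open>The recursion peels off the first step; evolving a law forward in time appends a last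
  one, which is the form behind \<open>invariant_kernel_power\<close> and
  \<open>state_law_Suc\<close>.\<close>

lemma kernel_power_Suc_right:
  "kernel_power K (Suc n) s s' = (\<Sum>u\<in>UNIV. kernel_power K n s u * K u s')"
proof (induction n arbitrary: s)
  case 0
  show ?case by (simp add: if_distrib if_distribR cong: if_cong)
next
  case (Suc n)
  have "kernel_power K (Suc (Suc n)) s s' =
      (\<Sum>v\<in>UNIV. K s v * (\<Sum>u\<in>UNIV. kernel_power K n v u * K u s'))"
    using Suc by simp
  also have "\<dots> = (\<Sum>v\<in>UNIV. \<Sum>u\<in>UNIV. K s v * kernel_power K n v u * K u s')"
    by (simp add: sum_distrib_left mult.assoc)
  also have "\<dots> = (\<Sum>u\<in>UNIV. \<Sum>v\<in>UNIV. K s v * kernel_power K n v u * K u s')"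
    by (rule sum.swap)
  finally show ?case by (simp add: sum_distrib_right)
qed

lemma sum_kernel_power:
  assumes "stochastic_kernel K"
  shows "(\<Sum>s'\<in>UNIV. kernel_power K n s s') = 1"
proof (induction n arbitrary: s)
  case (Suc n)
  have "(\<Sum>s'\<in>UNIV. kernel_power K (Suc n) s s') =
      (\<Sum>u\<in>UNIV. \<Sum>s'\<in>UNIV. K s u * kernel_power K n u s')"
    by (simp add: sum.swap[of "\<lambda>s' u. K s u * kernel_power K n u s'"])
  also have "\<dots> = (\<Sum>u\<in>UNIV. K s u)"
    using Suc by (simp flip: sum_distrib_left)
  finally show ?case using assms by (simp add: stochastic_kernel_def)
qed simp

section \<open>Invariant vectors and uniqueness of the stationary law\<close>

lemma invariant_kernel_power:
  assumes "\<And>s'. (\<Sum>s\<in>UNIV. w s * K s s') = w s'"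
  shows "(\<Sum>s\<in>UNIV. w s * kernel_power K n s s') = w s'"
proof (induction n arbitrary: s')
  case 0
  show ?case by (simp add: if_distrib if_distribR cong: if_cong)
next
  case (Suc n)
  have "(\<Sum>s\<in>UNIV. w s * kernel_power K (Suc n) s s') =
      (\<Sum>s\<in>UNIV. \<Sum>u\<in>UNIV. w s * kernel_power K n s u * K u s')"
    by (simp only: kernel_power_Suc_right sum_distrib_left mult.assoc)
  also have "\<dots> = (\<Sum>u\<in>UNIV. \<Sum>s\<in>UNIV. w s * kernel_power K n s u * K u s')"
    by (rule sum.swap)
  also have "\<dots> = (\<Sum>u\<in>UNIV. w u * K u s')"
    by (simp add: Suc flip: sum_distrib_right)
  finally show ?case by (simp only: assms)
qed

text \<open>By irreducibility some power of K leads from \<open>s\<close> to \<open>s'\<close>;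
  invariance under that power bounds \<open>w s'\<close> below by the mass arriving from
  \<open>s\<close>. Here \<open>w\<close> is a vector rather than a law, so that differences of
  multiples of laws are covered.\<close>

lemma invariant_positive:
  assumes "stochastic_kernel K" "irreducible_kernel K"
    and "\<And>s'. (\<Sum>s\<in>UNIV. w s * K s s') = w s'"
    and "\<And>s. w s \<ge> 0" and "w s > 0"
  shows "w s' > 0"
proof -
  obtain n where "kernel_power K n s s' > 0"
    using assms(2) by (auto simp: irreducible_kernel_def)
  then have "0 < w s * kernel_power K n s s'" using assms(5) by simp
  also have "\<dots> \<le> (\<Sum>s\<in>UNIV. w s * kernel_power K n s s')"
    by (rule member_le_sum) (auto simp: assms(4) kernel_power_nonneg[OF assms(1)])
  also have "\<dots> = w s'" by (rule invariant_kernel_power[OF assms(3)])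
  finally show ?thesis .
qed

text \<open>Subtract the largest multiple of \<open>\<nu>\<close> lying below \<open>\<nu>'\<close>: the difference is invariant, nonnegative and
  vanishes somewhere, hence everywhere.\<close>

lemma stationary_unique:
  assumes K: "stochastic_kernel K" "irreducible_kernel K"
    and \<nu>: "stationary K \<nu>" and \<nu>': "stationary K \<nu>'"
  shows "\<nu> = \<nu>'"
proof -
  \<comment> \<open>A point of the support propagates to full support, so the quotients by
    \<open>pmf \<nu> s\<close> below have positive denominators.\<close>
  obtain s1 where "s1 \<in> set_pmf \<nu>" using set_pmf_not_empty by fast
  then have "pmf \<nu> s1 > 0" by (simp add: pmf_positive)
  then have pos: "pmf \<nu> s > 0" for s
    using invariant_positive[OF K, of "pmf \<nu>" s1 s] \<nu> by (simp add: stationary_def)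
  define c where "c = Min (range (\<lambda>s. pmf \<nu>' s / pmf \<nu> s))"
  have "c \<in> range (\<lambda>s. pmf \<nu>' s / pmf \<nu> s)" unfolding c_def by (rule Min_in) auto
  then obtain s0 where s0: "c = pmf \<nu>' s0 / pmf \<nu> s0" by auto
  have le: "c \<le> pmf \<nu>' s / pmf \<nu> s" for s unfolding c_def by (rule Min_le) auto
  define w where "w s = pmf \<nu>' s - c * pmf \<nu> s" for s
  have nonneg: "w s \<ge> 0" for s using le[of s] pos[of s] by (simp add: w_def field_simps)
  have "w s0 = 0" using pos[of s0] by (simp add: w_def s0)
  have "(\<Sum>s\<in>UNIV. w s * K s s') = w s'" for s'
  proof -
    have "(\<Sum>s\<in>UNIV. w s * K s s') =
        (\<Sum>s\<in>UNIV. pmf \<nu>' s * K s s') - c * (\<Sum>s\<in>UNIV. pmf \<nu> s * K s s')"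
      by (simp add: w_def left_diff_distrib sum_subtractf sum_distrib_left mult.assoc)
    then show ?thesis using \<nu> \<nu>' by (simp add: stationary_def w_def)
  qed
  \<comment> \<open>A positive value of \<open>w\<close> anywhere would propagate to
    \<open>s0\<close>, where \<open>w\<close> vanishes.\<close>
  then have "w s = 0" for s
    using invariant_positive[OF K, of w s s0] nonneg \<open>w s0 = 0\<close>
    by (metis less_irrefl order_le_less)
  then have eq: "pmf \<nu>' s = c * pmf \<nu> s" for s by (simp add: w_def)
  have "(\<Sum>s\<in>UNIV. pmf \<nu>' s) = c * (\<Sum>s\<in>UNIV. pmf \<nu> s)"
    by (simp only: eq sum_distrib_left)
  then have "c = 1" by simp
  then show ?thesis using eq by (intro pmf_eqI) simp
qed

text \<open>Otherwise infinitely many terms stay a fixed distance away from \<open>l\<close>;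
  compactness gives them a convergent subsequence, whose limit must be \<open>l\<close>, a
  contradiction.\<close>

lemma tendsto_if_unique_limit_point:
  fixes X :: "nat \<Rightarrow> 'a::metric_space"
  assumes "compact C" and "\<And>n. X n \<in> C"
    and lim: "\<And>r l'. strict_mono r \<Longrightarrow> (X \<circ> r) \<longlonglongrightarrow> l' \<Longrightarrow> l' = l"
  shows "X \<longlonglongrightarrow> l"
proof (rule ccontr)
  assume "\<not> X \<longlonglongrightarrow> l"
  then obtain e where e: "e > 0" "\<exists>\<^sub>F n in sequentially. \<not> dist (X n) l < e"
    by (auto simp: tendsto_iff not_eventually)
  define B where "B = {n. \<not> dist (X n) l < e}"
  have "infinite B"
    using e(2) by (simp add: B_def frequently_cofinite flip: cofinite_eq_sequentially)
  \<comment> \<open>\<open>enumerate B\<close> lists the bad indices increasingly, so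
    \<open>X \<circ> r\<close> is a subsequence that never comes within \<open>e\<close> of
    \<open>l\<close>.\<close>
  define r where "r = enumerate B"
  have r: "strict_mono r" "\<And>n. r n \<in> B"
    using \<open>infinite B\<close> by (auto simp: r_def strict_mono_enumerate enumerate_in_set)
  obtain l' q where q: "strict_mono q" "((X \<circ> r) \<circ> q) \<longlonglongrightarrow> l'"
    using \<open>compact C\<close> assms(2) unfolding compact_def by (metis comp_apply)
  then have "l' = l"
    using lim[of "r \<circ> q"] r(1) by (simp add: strict_mono_o comp_assoc)
  with q(2) have "\<forall>\<^sub>F n in sequentially. dist (X (r (q n))) l < e"
    using e(1) by (simp add: tendsto_iff)
  then show False using r(2) by (auto simp: B_def)
qed

section \<open>Time-averaged state laws and their limit\<close>

definition state_law :: "('s::finite \<Rightarrow> 's \<Rightarrow> real) \<Rightarrow> 's pmf \<Rightarrow> nat \<Rightarrow> 's \<Rightarrow> real" where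
  "state_law K \<mu> t u = (\<Sum>s\<in>UNIV. pmf \<mu> s * kernel_power K t s u)"

lemma state_law_nonneg: "stochastic_kernel K \<Longrightarrow> state_law K \<mu> t u \<ge> 0"
  by (simp add: state_law_def sum_nonneg kernel_power_nonneg)

lemma sum_state_law:
  assumes "stochastic_kernel K"
  shows "(\<Sum>u\<in>UNIV. state_law K \<mu> t u) = 1"
proof -
  have "(\<Sum>u\<in>UNIV. state_law K \<mu> t u) =
      (\<Sum>s\<in>UNIV. \<Sum>u\<in>UNIV. pmf \<mu> s * kernel_power K t s u)"
    unfolding state_law_def by (rule sum.swap)
  then show ?thesis by (simp add: sum_kernel_power[OF assms] flip: sum_distrib_left)
qed

lemma state_law_le_1: "stochastic_kernel K \<Longrightarrow> state_law K \<mu> t u \<le> 1"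
  using member_le_sum[of u UNIV "state_law K \<mu> t"]
  by (simp add: sum_state_law state_law_nonneg)

lemma state_law_Suc: "state_law K \<mu> (Suc t) v = (\<Sum>u\<in>UNIV. state_law K \<mu> t u * K u v)"
proof -
  have "state_law K \<mu> (Suc t) v =
      (\<Sum>s\<in>UNIV. \<Sum>u\<in>UNIV. pmf \<mu> s * kernel_power K t s u * K u v)"
    by (simp only: state_law_def kernel_power_Suc_right sum_distrib_left mult.assoc)
  also have "\<dots> = (\<Sum>u\<in>UNIV. \<Sum>s\<in>UNIV. pmf \<mu> s * kernel_power K t s u * K u v)"
    by (rule sum.swap)
  finally show ?thesis by (simp add: state_law_def sum_distrib_right)
qed

text \<open>The normalised occupation measure: \<open>state_law K \<mu> t\<close> is the law of
  s(t+1), so t < T covers the states s(1), ..., s(T). It is a vector rather than a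
  \<open>pmf\<close> so that compactness of a box in \<open>real ^ 's\<close> applies, and because T
  = 0 gives the zero vector.\<close>

definition mean_law :: "('s::finite \<Rightarrow> 's \<Rightarrow> real) \<Rightarrow> 's pmf \<Rightarrow> nat \<Rightarrow> real ^ 's" where
  "mean_law K \<mu> T = (\<chi> u. (\<Sum>t<T. state_law K \<mu> t u) / real T)"

lemma mean_law_in_cbox:
  assumes "stochastic_kernel K"
  shows "mean_law K \<mu> T \<in> cbox 0 1"
proof -
  have "(\<Sum>t<T. state_law K \<mu> t u) \<le> real T" for u
    using sum_bounded_above[of "{..<T}" "\<lambda>t. state_law K \<mu> t u" 1]
    by (simp add: state_law_le_1[OF assms])
  moreover have "(\<Sum>t<T. state_law K \<mu> t u) \<ge> 0" for u
    by (simp add: sum_nonneg state_law_nonneg[OF assms])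
  ultimately show ?thesis
    by (auto simp: mem_box_cart mean_law_def divide_le_eq_1)
qed

lemma sum_mean_law:
  assumes "stochastic_kernel K" "T > 0"
  shows "(\<Sum>u\<in>UNIV. mean_law K \<mu> T $ u) = 1"
proof -
  have "(\<Sum>u\<in>UNIV. \<Sum>t<T. state_law K \<mu> t u) = (\<Sum>t<T. \<Sum>u\<in>UNIV. state_law K \<mu> t u)"
    by (rule sum.swap)
  then show ?thesis
    using assms by (simp add: mean_law_def sum_state_law flip: sum_divide_distrib)
qed

text \<open>Applying K shifts the time window by one, so all but the two end terms
  telescope.\<close>

lemma mean_law_step:
  "(\<Sum>u\<in>UNIV. mean_law K \<mu> T $ u * K u v) - mean_law K \<mu> T $ v =
     (state_law K \<mu> T v - state_law K \<mu> 0 v) / real T"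
proof -
  have "(\<Sum>u\<in>UNIV. mean_law K \<mu> T $ u * K u v) =
      (\<Sum>u\<in>UNIV. \<Sum>t<T. state_law K \<mu> t u * K u v) / real T"
    by (simp add: mean_law_def sum_divide_distrib sum_distrib_right)
  also have "(\<Sum>u\<in>UNIV. \<Sum>t<T. state_law K \<mu> t u * K u v) =
      (\<Sum>t<T. \<Sum>u\<in>UNIV. state_law K \<mu> t u * K u v)"
    by (rule sum.swap)
  also have "\<dots> = (\<Sum>t<T. state_law K \<mu> (Suc t) v)" by (simp add: state_law_Suc)
  finally have "(\<Sum>u\<in>UNIV. mean_law K \<mu> T $ u * K u v) - mean_law K \<mu> T $ v =
      (\<Sum>t<T. state_law K \<mu> (Suc t) v - state_law K \<mu> t v) / real T"
    by (simp add: mean_law_def sum_subtractf diff_divide_distrib)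
  then show ?thesis by (simp only: sum_lessThan_telescope[of "\<lambda>t. state_law K \<mu> t v"])
qed

text \<open>The two end terms are probabilities, so the defect of invariance is at most 1/T.\<close>

lemma mean_law_step_tendsto_0:
  assumes "stochastic_kernel K"
  shows "(\<lambda>T. (\<Sum>u\<in>UNIV. mean_law K \<mu> T $ u * K u v) - mean_law K \<mu> T $ v) \<longlonglongrightarrow> 0"
proof (rule Lim_null_comparison)
  have "\<bar>state_law K \<mu> T v - state_law K \<mu> 0 v\<bar> \<le> 1" for T
    using state_law_nonneg[OF assms, of \<mu> _ v] state_law_le_1[OF assms, of \<mu> _ v]
    by (smt (verit))
  then show "\<forall>\<^sub>F T in sequentially.
      norm ((\<Sum>u\<in>UNIV. mean_law K \<mu> T $ u * K u v) - mean_law K \<mu> T $ v) \<le> 1 / real T"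
    unfolding mean_law_step by (intro always_eventually) (simp add: divide_right_mono)
qed (rule lim_1_over_n)

text \<open>Nonnegativity, total mass 1 and invariance are closed conditions; the mean laws meet the
  first two for T > 0 and the third up to a vanishing defect.\<close>

lemma limit_of_mean_laws_stationary:
  assumes K: "stochastic_kernel K" and r: "strict_mono r"
    and lim: "(mean_law K \<mu> \<circ> r) \<longlonglongrightarrow> l"
  obtains \<nu> where "stationary K \<nu>" "l = (\<chi> s. pmf \<nu> s)"
proof -
  have lim': "(\<lambda>n. mean_law K \<mu> (r n) $ u) \<longlonglongrightarrow> l $ u" for u
    using tendsto_vec_nth[OF lim] by simp
  have "l $ u \<ge> 0" for u
    using lim' mean_law_in_cbox[OF K]
    by (intro LIMSEQ_le_const[OF lim']) (auto simp: mem_box_cart)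
  moreover have "(\<Sum>u\<in>UNIV. l $ u) = 1"
  proof (rule LIMSEQ_unique[OF tendsto_sum[OF lim']])
    \<comment> \<open>Strict monotonicity gives \<open>r n \<ge> n\<close>, which keeps clear of T =
      0, where the total mass is 0.\<close>
    have "r n > 0" if "n > 0" for n using seq_suble[OF r, of n] that by simp
    then have "\<forall>\<^sub>F n in sequentially. (\<Sum>u\<in>UNIV. mean_law K \<mu> (r n) $ u) = 1"
      using sum_mean_law[OF K] by (intro eventually_sequentiallyI[of 1]) auto
    then show "(\<lambda>n. \<Sum>u\<in>UNIV. mean_law K \<mu> (r n) $ u) \<longlonglongrightarrow> 1"
      by (rule tendsto_eventually)
  qed
  \<comment> \<open>The limit is only a vector so far; nonnegativity and mass 1 let
    \<open>embed_pmf\<close> realise it as a law.\<close>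
  ultimately have pmf: "pmf (embed_pmf (\<lambda>u. l $ u)) s = l $ s" for s
    by (intro pmf_embed_pmf) (auto simp: nn_integral_count_space_finite sum_ennreal)
  have "(\<Sum>u\<in>UNIV. l $ u * K u v) - l $ v = 0" for v
  proof (rule LIMSEQ_unique)
    show "(\<lambda>n. (\<Sum>u\<in>UNIV. mean_law K \<mu> (r n) $ u * K u v) - mean_law K \<mu> (r n) $ v)
        \<longlonglongrightarrow> (\<Sum>u\<in>UNIV. l $ u * K u v) - l $ v"
      by (intro tendsto_intros lim')
    show "(\<lambda>n. (\<Sum>u\<in>UNIV. mean_law K \<mu> (r n) $ u * K u v) - mean_law K \<mu> (r n) $ v)
        \<longlonglongrightarrow> 0"
      using LIMSEQ_subseq_LIMSEQ[OF mean_law_step_tendsto_0[OF K] r] by (simp add: o_def)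
  qed
  then show thesis
    by (intro that[of "embed_pmf (\<lambda>u. l $ u)"]) (auto simp: stationary_def pmf vec_eq_iff)
qed

text \<open>The Krylov-Bogoliubov argument: compactness gives the mean laws a limit point, and it is
  stationary.\<close>

lemma stationary_exists:
  assumes "stochastic_kernel K"
  obtains \<nu> where "stationary K \<nu>"
proof -
  \<comment> \<open>Any initial law will do; \<open>undefined\<close> stands for an arbitrary
    one.\<close>
  obtain l r where "strict_mono r" "(mean_law K undefined \<circ> r) \<longlonglongrightarrow> l"
    using compact_cbox[of "0 :: real ^ 'a" 1] mean_law_in_cbox[OF assms]
    unfolding compact_def by metis
  then show thesis using limit_of_mean_laws_stationary[OF assms] that by metis
qed

lemma stationary_distribution_eqI:
  assumes "ergodic_policy p \<pi>" "stationary (kernel p \<pi>) \<nu>"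
  shows "stationary_distribution p \<pi> = \<nu>"
  unfolding stationary_distribution_def
  using assms stationary_unique[OF stochastic_kernel_kernel]
  by (intro the_equality) (auto simp: ergodic_policy_def)

text \<open>The ergodic theorem in Cesaro form: compactness turns uniqueness of the limit point into
  convergence, with the same limit for every initial law.\<close>

lemma mean_law_tendsto:
  assumes "stochastic_kernel K" "irreducible_kernel K" "stationary K \<nu>"
  shows "mean_law K \<mu> \<longlonglongrightarrow> (\<chi> s. pmf \<nu> s)"
proof (rule tendsto_if_unique_limit_point[OF compact_cbox mean_law_in_cbox[OF assms(1)]])
  fix r l assume "strict_mono r" "(mean_law K \<mu> \<circ> r) \<longlonglongrightarrow> l"
  then show "l = (\<chi> s. pmf \<nu> s)"
    by (metis limit_of_mean_laws_stationary[OF assms(1)] stationary_unique[OF assms(1,2) assms(3)])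
qed

section \<open>Expected rewards in terms of the mean laws\<close>

definition mean_payoff ::
  "('s::finite, 'a::finite) transition \<Rightarrow> ('s, 'a) payoff \<Rightarrow> ('s, 'a) policy \<Rightarrow> 's \<Rightarrow> real" where
  "mean_payoff p R \<pi> s =
     (\<Sum>a\<in>UNIV. pmf (\<pi> s) a * (\<Sum>s'\<in>UNIV. pmf (p s a) s' * R s a s'))"

text \<open>Finite support makes total payoffs integrable and lets expectations over binds be
  expanded as finite sums.\<close>

lemma finite_set_trajectory:
  fixes p :: "('s::finite, 'a::finite) transition"
  shows "finite (set_pmf (trajectory p \<pi> T s))"
  by (induction T arbitrary: s) auto

text \<open>Condition on the first transition: the head of the list contributes its payoff, the tail
  is a trajectory of length T from the new state.\<close>

lemma expectation_trajectory_Suc: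
  fixes p :: "('s::finite, 'a::finite) transition" and R :: "('s, 'a) payoff"
    and \<pi> :: "('s, 'a) policy"
  defines "V \<equiv> \<lambda>T s. measure_pmf.expectation (trajectory p \<pi> T s)
    (\<lambda>xs. \<Sum>(s, a, s')\<leftarrow>xs. R s a s')"
  shows "V (Suc T) s = mean_payoff p R \<pi> s + (\<Sum>u\<in>UNIV. kernel p \<pi> s u * V T u)"
proof -
  have step: "measure_pmf.expectation (map_pmf (\<lambda>xs. (s, a, s') # xs) (trajectory p \<pi> T s'))
      (\<lambda>xs. \<Sum>(s, a, s')\<leftarrow>xs. R s a s') = R s a s' + V T s'" for a s'
    unfolding V_def integral_map_pmf
    by (simp add: integrable_measure_pmf_finite[OF finite_set_trajectory])
  have inner: "measure_pmf.expectation (p s a \<bind>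
        (\<lambda>s'. map_pmf (\<lambda>xs. (s, a, s') # xs) (trajectory p \<pi> T s')))
      (\<lambda>xs. \<Sum>(s, a, s')\<leftarrow>xs. R s a s') = (\<Sum>s'\<in>UNIV. pmf (p s a) s' * (R s a s' + V T s'))" for a
    by (subst pmf_expectation_bind[where A = UNIV])
       (simp_all only: step finite_set_trajectory finite set_map_pmf finite_imageI
         subset_UNIV real_scaleR_def)
  have "measure_pmf.expectation (trajectory p \<pi> (Suc T) s) (\<lambda>xs. \<Sum>(s, a, s')\<leftarrow>xs. R s a s') =
      (\<Sum>a\<in>UNIV. pmf (\<pi> s) a * (\<Sum>s'\<in>UNIV. pmf (p s a) s' * (R s a s' + V T s')))"
    unfolding trajectory.simps
    by (subst pmf_expectation_bind[where A = UNIV])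
       (simp_all only: inner finite_set_trajectory finite set_map_pmf set_bind_pmf finite_imageI
         finite_UN_I subset_UNIV real_scaleR_def)
  \<comment> \<open>\<open>V_def\<close> is instantiated at \<open>Suc T\<close> and
    \<open>s\<close>, so that the occurrences of \<open>V T\<close> stay folded.\<close>
  then show ?thesis
    unfolding meta_eq_to_obj_eq[OF V_def, THEN fun_cong, THEN fun_cong, of "Suc T" s]
    by (simp add: sum_kernel mean_payoff_def distrib_left sum.distrib)
qed

lemma expectation_trajectory:
  fixes p :: "('s::finite, 'a::finite) transition" and R :: "('s, 'a) payoff"
  shows "measure_pmf.expectation (trajectory p \<pi> T s) (\<lambda>xs. \<Sum>(s, a, s')\<leftarrow>xs. R s a s') =
    (\<Sum>t<T. \<Sum>u\<in>UNIV. kernel_power (kernel p \<pi>) t s u * mean_payoff p R \<pi> u)"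
proof (induction T arbitrary: s)
  case (Suc T)
  let ?K = "kernel p \<pi>" and ?r = "mean_payoff p R \<pi>"
  have "(\<Sum>v\<in>UNIV. ?K s v * (\<Sum>t<T. \<Sum>u\<in>UNIV. kernel_power ?K t v u * ?r u)) =
      (\<Sum>v\<in>UNIV. \<Sum>t<T. \<Sum>u\<in>UNIV. ?K s v * kernel_power ?K t v u * ?r u)"
    by (simp add: sum_distrib_left mult.assoc)
  also have "\<dots> = (\<Sum>t<T. \<Sum>v\<in>UNIV. \<Sum>u\<in>UNIV. ?K s v * kernel_power ?K t v u * ?r u)"
    by (rule sum.swap)
  also have "\<dots> = (\<Sum>t<T. \<Sum>u\<in>UNIV. \<Sum>v\<in>UNIV. ?K s v * kernel_power ?K t v u * ?r u)"
    by (intro sum.cong refl sum.swap)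
  also have "\<dots> = (\<Sum>t<T. \<Sum>u\<in>UNIV. kernel_power ?K (Suc t) s u * ?r u)"
    by (simp add: sum_distrib_right)
  \<comment> \<open>The shift splits off t = 0, where the kernel power is the identity and leaves
    the payoff at \<open>s\<close> itself.\<close>
  finally show ?case
    unfolding expectation_trajectory_Suc Suc sum.lessThan_Suc_shift
    by (simp add: if_distrib if_distribR cong: if_cong)
qed simp

text \<open>After the sums are exchanged, T enters through the mean law alone, so convergence of the
  mean laws carries over to rewards.\<close>

lemma expected_total_reward_eq:
  fixes p :: "('s::finite, 'a::finite) transition"
  shows "1 / real T * expected_total_reward p R \<mu> \<pi> T =
    (\<Sum>u\<in>UNIV. mean_law (kernel p \<pi>) \<mu> T $ u * mean_payoff p R \<pi> u)"
proof -
  let ?K = "kernel p \<pi>" and ?r = "mean_payoff p R \<pi>"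
  have "expected_total_reward p R \<mu> \<pi> T =
      (\<Sum>s\<in>UNIV. pmf \<mu> s * (\<Sum>t<T. \<Sum>u\<in>UNIV. kernel_power ?K t s u * ?r u))"
    unfolding expected_total_reward_def
    by (subst pmf_expectation_bind[where A = UNIV])
       (auto simp: finite_set_trajectory expectation_trajectory)
  also have "\<dots> = (\<Sum>s\<in>UNIV. \<Sum>t<T. \<Sum>u\<in>UNIV. pmf \<mu> s * kernel_power ?K t s u * ?r u)"
    by (simp add: sum_distrib_left mult.assoc)
  also have "\<dots> = (\<Sum>t<T. \<Sum>s\<in>UNIV. \<Sum>u\<in>UNIV. pmf \<mu> s * kernel_power ?K t s u * ?r u)"
    by (rule sum.swap)
  also have "\<dots> = (\<Sum>t<T. \<Sum>u\<in>UNIV. \<Sum>s\<in>UNIV. pmf \<mu> s * kernel_power ?K t s u * ?r u)"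
    by (intro sum.cong refl sum.swap)
  also have "\<dots> = (\<Sum>u\<in>UNIV. \<Sum>t<T. \<Sum>s\<in>UNIV. pmf \<mu> s * kernel_power ?K t s u * ?r u)"
    by (rule sum.swap)
  finally show ?thesis
    by (simp add: mean_law_def state_law_def sum_distrib_right sum_divide_distrib)
qed

text \<open>The right-hand side is the limit of a finite linear combination of mean law entries;
  this convergence also gives the \<open>lim\<close> in \<open>average_reward\<close> its
  meaning.\<close>

lemma average_reward_eq:
  fixes p :: "('s::finite, 'a::finite) transition"
  assumes "ergodic_policy p \<pi>" "stationary (kernel p \<pi>) \<nu>"
  shows "average_reward p R \<mu> \<pi> = (\<Sum>s\<in>UNIV. pmf \<nu> s * mean_payoff p R \<pi> s)"
proof -
  have "mean_law (kernel p \<pi>) \<mu> \<longlonglongrightarrow> (\<chi> s. pmf \<nu> s)"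
    using assms by (intro mean_law_tendsto stochastic_kernel_kernel) (auto simp: ergodic_policy_def)
  from tendsto_vec_nth[OF this]
  have "(\<lambda>T. mean_law (kernel p \<pi>) \<mu> T $ u) \<longlonglongrightarrow> pmf \<nu> u" for u by simp
  then have "(\<lambda>T. 1 / real T * expected_total_reward p R \<mu> \<pi> T)
      \<longlonglongrightarrow> (\<Sum>s\<in>UNIV. pmf \<nu> s * mean_payoff p R \<pi> s)"
    unfolding expected_total_reward_eq by (intro tendsto_intros)
  then show ?thesis unfolding average_reward_def by (rule limI)
qed

section \<open>The performance difference identity\<close>

lemma expectation_state_action_law:
  fixes \<nu> :: "'s::finite pmf" and \<pi> :: "('s, 'a::finite) policy" and f :: "'s \<times> 'a \<Rightarrow> real"
  shows "measure_pmf.expectation (state_action_law \<nu> \<pi>) f =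
    (\<Sum>s\<in>UNIV. \<Sum>a\<in>UNIV. pmf \<nu> s * pmf (\<pi> s) a * f (s, a))"
  unfolding state_action_law_def
  by (subst pmf_expectation_bind[where A = UNIV])
     (auto simp: integral_measure_pmf[of UNIV] sum_distrib_left mult.assoc)

text \<open>The Bellman equation for \<open>Q\<close> holds at each action separately, so it may be
  averaged with the weights of another policy; the constants \<rho>(\<pi>) and \<open>h s\<close>
  pass through because the weights sum to 1.\<close>

lemma mean_advantage:
  assumes "differential_values p R \<mu> \<pi> h Q"
  shows "(\<Sum>a\<in>UNIV. pmf (\<pi>' s) a * advantage h Q s a) =
    mean_payoff p R \<pi>' s - average_reward p R \<mu> \<pi> + (\<Sum>u\<in>UNIV. kernel p \<pi>' s u * h u) - h s"
proof -
  have "Q s a = (\<Sum>u\<in>UNIV. pmf (p s a) u * R s a u) - average_reward p R \<mu> \<pi> +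
      (\<Sum>u\<in>UNIV. pmf (p s a) u * h u)" for a
  proof -
    have "Q s a = (\<Sum>u\<in>UNIV. pmf (p s a) u * (R s a u - average_reward p R \<mu> \<pi> + h u))"
      using assms unfolding differential_values_def by blast
    then show ?thesis
      by (simp add: distrib_left right_diff_distrib sum.distrib sum_subtractf)
  qed
  then show ?thesis
    by (simp add: advantage_def sum_kernel mean_payoff_def distrib_left right_diff_distrib
        sum.distrib sum_subtractf)
qed

theorem lemma4p4:
  fixes p :: "('s::finite, 'a::finite) transition"
    and R :: "('s, 'a) payoff"
    and \<mu> :: "'s pmf"
    and \<pi> \<pi>' :: "('s, 'a) policy"
    and h :: "'s \<Rightarrow> real" and Q :: "'s \<Rightarrow> 'a \<Rightarrow> real"
  assumes "ergodic_policy p \<pi>" and "ergodic_policy p \<pi>'"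
    and "differential_values p R \<mu> \<pi> h Q"
  shows "average_reward p R \<mu> \<pi>' - average_reward p R \<mu> \<pi> =
           measure_pmf.expectation (state_action_law (stationary_distribution p \<pi>') \<pi>')
             (\<lambda>(s, a). advantage h Q s a)
         \<and> measure_pmf.expectation (state_action_law (stationary_distribution p \<pi>') \<pi>')
             (\<lambda>(s, a). advantage h Q s a) =
           (\<Sum>s\<in>UNIV. \<Sum>a\<in>UNIV.
              pmf (stationary_distribution p \<pi>') s * pmf (\<pi>' s) a * advantage h Q s a)"
proof -
  obtain \<nu> where \<nu>: "stationary (kernel p \<pi>') \<nu>"
    using stationary_exists[OF stochastic_kernel_kernel] by blast
  let ?\<rho> = "average_reward p R \<mu>"
  \<comment> \<open>By invariance of \<open>\<nu>\<close>, the mean of \<open>h\<close> is the same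
    before and after one step under \<open>\<pi>'\<close>.\<close>
  have "(\<Sum>s\<in>UNIV. pmf \<nu> s * (\<Sum>u\<in>UNIV. kernel p \<pi>' s u * h u)) =
      (\<Sum>s\<in>UNIV. \<Sum>u\<in>UNIV. pmf \<nu> s * kernel p \<pi>' s u * h u)"
    by (simp add: sum_distrib_left mult.assoc)
  also have "\<dots> = (\<Sum>u\<in>UNIV. \<Sum>s\<in>UNIV. pmf \<nu> s * kernel p \<pi>' s u * h u)"
    by (rule sum.swap)
  also have "\<dots> = (\<Sum>u\<in>UNIV. pmf \<nu> u * h u)"
    using \<nu> by (simp add: stationary_def flip: sum_distrib_right)
  finally have cancel: "(\<Sum>s\<in>UNIV. pmf \<nu> s * (\<Sum>u\<in>UNIV. kernel p \<pi>' s u * h u)) =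
      (\<Sum>u\<in>UNIV. pmf \<nu> u * h u)" .
  have "(\<Sum>s\<in>UNIV. \<Sum>a\<in>UNIV. pmf \<nu> s * pmf (\<pi>' s) a * advantage h Q s a) =
      (\<Sum>s\<in>UNIV. pmf \<nu> s * (\<Sum>a\<in>UNIV. pmf (\<pi>' s) a * advantage h Q s a))"
    by (simp add: sum_distrib_left mult.assoc)
  \<comment> \<open>Only \<rho>(\<pi>') is rewritten through \<open>\<nu>\<close>; \<rho>(\<pi>)
    stays a constant, kept intact by the unit mass of \<open>\<nu>\<close>.\<close>
  also have "\<dots> = ?\<rho> \<pi>' - ?\<rho> \<pi>"
    unfolding mean_advantage[OF assms(3)] average_reward_eq[OF assms(2) \<nu>]
    by (simp add: distrib_left right_diff_distrib sum.distrib sum_subtractf cancel)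
  finally show ?thesis
    by (simp add: stationary_distribution_eqI[OF assms(2) \<nu>] expectation_state_action_law)
qed

end
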